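(* Let $J=(a_0,+\infty)$ with $a_0\in\mathbb{R}\cup\{-\infty\}$, let $h\colon J\to(0,+\infty)$ be a growth rate, put $e_\ast=h^{-1}(1)$, $J^-=(a_0,e_\ast]$, $J^+=[e_\ast,+\infty)$, and let $A\colon J\to M_n(\mathbb{R})$ be continuous. The system $x'=A(t)x$, $t\in J$, has a uniform $h$-dichotomy on $J$ if and only if the following three conditions hold: a) the system has uniform $h$-dichotomies on $J^-$ and on $J^+$, with projections $P^-(\cdot)$ and $P^+(\cdot)$ respectively; b) the system has no nontrivial solutions bounded on $J$; c) the index of the system is $i(A)=0$.
   Context: Fix a norm $|\cdot|$ on $\mathbb{R}^n$ with induced matrix norm $\|\cdot\|$. $\Phi(t,s)$ denotes the transition matrix of $x'=A(t)x$. Growth rate: a strictly increasing homeomorphism $h\colon J=(a_0,+\infty)\to(0,+\infty)$. Uniform $h$-dichotomy on an interval $\mathcal{I}\subseteq J$: there exist projectors $P(t)$ ($P(t)^2=P(t)$), $t\in\mathcal{I}$, and constants $K\ge1$, $\alpha>0$ such that $P(t)\Phi(t,s)=\Phi(t,s)P(s)$ for all $t,s\in\mathcal{I}$; $\|\Phi(t,s)P(s)\|\le K(h(t)/h(s))^{-\alpha}$ for all $t\ge s$ in $\mathcal{I}$; and $\|\Phi(t,s)(I-P(s))\|\le K(h(s)/h(t))^{-\alpha}$ for all $s\ge t$ in $\mathcal{I}$. Index: for an $n$-dimensional system having uniform $h$-dichotomies on $J^-$ and on $J^+$ with projections $P^-(\cdot)$ and $P^+(\cdot)$ respectively, $i(A)=\dim\mathcal{R}P^+(\cdot)+\dim\mathcal{N}P^-(\cdot)-n$,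 where $\mathcal{R}$ denotes range and $\mathcal{N}$ denotes kernel (by the invariance property these dimensions do not depend on the time argument). *)

theory Defs
  imports "HOL-Analysis.Analysis"
begin

definition is_norm :: "('a::real_vector \<Rightarrow> real) \<Rightarrow> bool" where
  "is_norm N \<longleftrightarrow>
     (\<forall>x. N x = 0 \<longleftrightarrow> x = 0) \<and>
     (\<forall>c x. N (c *\<^sub>R x) = \<bar>c\<bar> * N x) \<and>
     (\<forall>x y. N (x + y) \<le> N x + N y)"

text \<open>As in the library's \<open>onorm\<close>, the vector \<open>x = 0\<close> contributes \<open>0 / 0 = 0\<close> to the supremum.\<close>

definition induced_norm :: "(real ^ 'n \<Rightarrow> real) \<Rightarrow> real ^ 'n ^ 'n \<Rightarrow> real" where
  "induced_norm N M = (SUP x. N (M *v x) / N x)"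

definition open_halfline :: "ereal \<Rightarrow> real set" where
  "open_halfline a\<^sub>0 = {t. a\<^sub>0 < ereal t}"

definition growth_rate :: "real set \<Rightarrow> (real \<Rightarrow> real) \<Rightarrow> bool" where
  "growth_rate J h \<longleftrightarrow> strict_mono_on J h \<and> (\<exists>g. homeomorphism J {0<..} h g)"

definition solves_linear_system ::
    "real set \<Rightarrow> (real \<Rightarrow> real ^ 'n ^ 'n) \<Rightarrow> (real \<Rightarrow> real ^ 'n) \<Rightarrow> bool" where
  "solves_linear_system J A x \<longleftrightarrow>
     (\<forall>t\<in>J. (x has_vector_derivative A t *v x t) (at t within J))"

text \<open>The value at time \<open>t\<close> of the matrix solution \<open>X\<close> of \<open>X' = A(t) X\<close> on \<open>J\<close> with
  \<open>X(s) = I\<close>. For an open interval \<open>J\<close>, \<open>A\<close> continuous on \<open>J\<close> and \<open>s, t \<in> J\<close> this value exists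
  and is unique; outside \<open>J\<close> it carries no meaning.\<close>

definition transition_matrix ::
    "real set \<Rightarrow> (real \<Rightarrow> real ^ 'n ^ 'n) \<Rightarrow> real \<Rightarrow> real \<Rightarrow> real ^ 'n ^ 'n" where
  "transition_matrix J A t s =
     (THE M. \<exists>X. (\<forall>u\<in>J. (X has_vector_derivative A u ** X u) (at u within J)) \<and>
                 X s = mat 1 \<and> X t = M)"

text \<open>Here \<open>J\<close> is the interval on which the system lives and \<open>I \<subseteq> J\<close> the interval of the dichotomy.
  Only the values \<open>P t\<close> with \<open>t \<in> I\<close> matter.\<close>

definition uniform_dichotomy_with ::
    "(real ^ 'n \<Rightarrow> real) \<Rightarrow> real set \<Rightarrow> (real \<Rightarrow> real) \<Rightarrow> (real \<Rightarrow> real ^ 'n ^ 'n) \<Rightarrow>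
     real set \<Rightarrow> (real \<Rightarrow> real ^ 'n ^ 'n) \<Rightarrow> bool" where
  "uniform_dichotomy_with N J h A I P \<longleftrightarrow>
     (\<forall>t\<in>I. P t ** P t = P t) \<and>
     (\<forall>t\<in>I. \<forall>s\<in>I. P t ** transition_matrix J A t s = transition_matrix J A t s ** P s) \<and>
     (\<exists>K \<alpha>. K \<ge> 1 \<and> \<alpha> > 0 \<and>
        (\<forall>t\<in>I. \<forall>s\<in>I. t \<ge> s \<longrightarrow>
           induced_norm N (transition_matrix J A t s ** P s) \<le> K * (h t / h s) powr (- \<alpha>)) \<and>
        (\<forall>t\<in>I. \<forall>s\<in>I. s \<ge> t \<longrightarrow>
           induced_norm N (transition_matrix J A t s ** (mat 1 - P s))
             \<le> K * (h s / h t) powr (- \<alpha>)))"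

definition has_uniform_dichotomy ::
    "(real ^ 'n \<Rightarrow> real) \<Rightarrow> real set \<Rightarrow> (real \<Rightarrow> real) \<Rightarrow> (real \<Rightarrow> real ^ 'n ^ 'n) \<Rightarrow>
     real set \<Rightarrow> bool" where
  "has_uniform_dichotomy N J h A I \<longleftrightarrow> (\<exists>P. uniform_dichotomy_with N J h A I P)"

text \<open>The projections \<open>Pm\<close> (on the left half-line) and \<open>Pp\<close> (on the right one) are evaluated at the
  common endpoint \<open>e\<close> of the two half-lines; by invariance the two dimensions do not depend on the
  time argument. The index may be negative, hence the type \<open>int\<close>.\<close>

definition dichotomy_index ::
    "real \<Rightarrow> (real \<Rightarrow> real ^ 'n ^ 'n) \<Rightarrow> (real \<Rightarrow> real ^ 'n ^ 'n) \<Rightarrow> int" where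
  "dichotomy_index e Pm Pp =
     int (dim (range (\<lambda>x. Pp e *v x))) + int (dim {x. Pm e *v x = 0}) - int CARD('n)"

end

theory Submission
  imports Defs
begin

text \<open>If the system has a dichotomy on \<open>J\<close>, the two components of a bounded solution at time \<open>s\<close>,
  obtained from its values near the left and the right end of \<open>J\<close>, are arbitrarily small, so the solution
  vanishes; the index condition is rank-nullity.

  Conversely, a vector in both the range of \<open>Pp e\<close> and the kernel of \<open>Pm e\<close> starts a solution bounded
  on \<open>J\<close>, so these spaces meet only in \<open>0\<close>, and index \<open>0\<close> makes them complementary. Let \<open>Q\<close> be
  the projector onto the first one along the second one and transport it by the flow. On the right
  half-line the result has the same range as \<open>Pp\<close>, on the left one the same kernel as \<open>Pm\<close>; in both
  cases it differs from the given projector by a bounded term, so the half-line estimates carry over,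
  and the estimates across \<open>e\<close> are products of those on the two sides.\<close>

subsection \<open>Linear differential equations\<close>

lemma einterval_Icc_subset:
  fixes p q :: real
  assumes "p \<in> einterval l r" "q \<in> einterval l r"
  shows "{p..q} \<subseteq> einterval l r"
proof
  fix x assume "x \<in> {p..q}"
  then have "ereal p \<le> ereal x" "ereal x \<le> ereal q" by auto
  with assms show "x \<in> einterval l r"
    unfolding einterval_iff by (meson order.strict_trans2 order.strict_trans1)
qed

text \<open>Compactness of \<open>{p..q}\<close> will bound the coefficient there. The strict
  inequalities keep \<open>t\<close> interior, so a derivative within \<open>{p..q}\<close> is a
  derivative at \<open>t\<close>.\<close>

lemma einterval_neighbourhood:
  fixes s t :: real
  assumes "s \<in> einterval l r" "t \<in> einterval l r"
  obtains p q where "p < s" "p < t" "s < q" "t < q" "{p..q} \<subseteq> einterval l r"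
proof -
  let ?m = "min s t" and ?M = "max s t"
  have "?m \<in> einterval l r" "?M \<in> einterval l r"
    using assms by (auto simp: min_def max_def)
  then obtain d1 d2 where d: "d1 > 0" "cball ?m d1 \<subseteq> einterval l r"
      "d2 > 0" "cball ?M d2 \<subseteq> einterval l r"
    using open_einterval open_contains_cball by meson
  have "?m - d1 \<in> einterval l r" "?M + d2 \<in> einterval l r"
    using d by (auto simp: subset_iff cball_def dist_real_def)
  then have "{?m - d1..?M + d2} \<subseteq> einterval l r" by (rule einterval_Icc_subset)
  moreover have "?m - d1 < s" "?m - d1 < t" "s < ?M + d2" "t < ?M + d2"
    using d by auto
  ultimately show thesis using that by blast
qed

lemma ex_antiderivative_einterval:
  fixes f :: "real \<Rightarrow> 'b::euclidean_space"
  assumes f: "continuous_on (einterval l r) f" and s: "s \<in> einterval l r"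
  shows "\<exists>F. F s = 0 \<and> (\<forall>t\<in>einterval l r. (F has_vector_derivative f t) (at t))"
proof -
  have lr: "l < r" using s by (auto simp: einterval_def)
  have "isCont f x" if "l < ereal x" "ereal x < r" for x
    using f that by (simp add: continuous_on_eq_continuous_at einterval_iff)
  then obtain F where F: "\<forall>x::real. l < x \<longrightarrow> x < r \<longrightarrow> (F has_vector_derivative f x) (at x)"
    using einterval_antiderivative[OF lr] by blast
  show ?thesis
    by (rule exI[of _ "\<lambda>t. F t - F s"])
       (use F in \<open>auto intro!: derivative_eq_intros simp: einterval_iff\<close>)
qed

section \<open>Weighted increment bounds and existence by Picard iteration\<close>

text \<open>The majorant of \<open>f\<close> has the antiderivative
  \<open>c / k * exp (k * (u - s))\<close>, and the mean value inequality compares increments. The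
  factor \<open>1 / k\<close> gained here makes the Picard steps contract.\<close>

lemma exponential_increment_bound_right:
  fixes F :: "real \<Rightarrow> 'b::real_normed_vector"
  assumes F: "\<And>u. s \<le> u \<Longrightarrow> u \<le> t \<Longrightarrow> (F has_vector_derivative f u) (at u)"
    and bound: "\<And>u. s \<le> u \<Longrightarrow> u \<le> t \<Longrightarrow> norm (f u) \<le> c * exp (k * (u - s))"
    and k: "k > 0" and st: "s \<le> t"
  shows "norm (F t - F s) \<le> c / k * exp (k * (t - s))"
proof -
  have c: "0 \<le> c" using order_trans[OF norm_ge_zero bound[of s]] st by simp
  show ?thesis
  proof (cases "s = t")
    case True then show ?thesis using c k by simp
  next
    case False
    let ?g = "\<lambda>u. c / k * exp (k * (u - s))"
    have "norm (F t - F s) \<le> ?g t - ?g s"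
    proof (rule differentiable_bound_general[where f' = f and \<phi>' = "\<lambda>u. c * exp (k * (u - s))"])
      show "s < t" using False st by simp
      show "continuous_on {s..t} F"
        using F by (auto intro!: continuous_at_imp_continuous_on has_vector_derivative_continuous)
      show "continuous_on {s..t} ?g" by (intro continuous_intros)
      show "(?g has_vector_derivative c * exp (k * (u - s))) (at u)" for u
        unfolding has_real_derivative_iff_has_vector_derivative[symmetric]
        using k by (auto intro!: derivative_eq_intros)
    qed (use F bound in auto)
    also have "\<dots> \<le> ?g t" using c k by simp
    finally show ?thesis .
  qed
qed

lemma exponential_increment_bound:
  fixes F :: "real \<Rightarrow> 'b::real_normed_vector"
  assumes F: "\<And>u. u \<in> {p..q} \<Longrightarrow> (F has_vector_derivative f u) (at u)"
    and bound: "\<And>u. u \<in> {p..q} \<Longrightarrow> norm (f u) \<le> c * exp (k * \<bar>u - s\<bar>)"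
    and k: "k > 0" and st: "s \<in> {p..q}" "t \<in> {p..q}"
  shows "norm (F t - F s) \<le> c / k * exp (k * \<bar>t - s\<bar>)"
proof (cases "s \<le> t")
  case True
  have bound': "norm (f u) \<le> c * exp (k * (u - s))" if "s \<le> u" "u \<le> t" for u
    using bound[of u] that st by simp
  have "norm (F t - F s) \<le> c / k * exp (k * (t - s))"
    by (rule exponential_increment_bound_right[of s t F f])
       (use F k st True bound' in auto)
  then show ?thesis using True by simp
next
  case False
  \<comment> \<open>Reversing time turns the case \<open>t < s\<close> into the one already
    proved.\<close>
  have "norm ((F \<circ> uminus) (- t) - (F \<circ> uminus) (- s)) \<le> c / k * exp (k * (- t - - s))"
  proof (rule exponential_increment_bound_right[of _ _ _ "\<lambda>u. - f (- u)"])
    fix u assume u: "- s \<le> u" "u \<le> - t"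
    then have mem: "- u \<in> {p..q}" using st by auto
    have "((F \<circ> uminus) has_vector_derivative (- 1) *\<^sub>R f (- u)) (at u)"
      by (rule vector_diff_chain_at) (auto intro!: derivative_eq_intros F[OF mem])
    then show "((F \<circ> uminus) has_vector_derivative - f (- u)) (at u)" by simp
    show "norm (- f (- u)) \<le> c * exp (k * (u - - s))"
    proof -
      have "\<bar>- u - s\<bar> = u - - s" using u by simp
      then show ?thesis using bound[OF mem] by (metis norm_minus_cancel)
    qed
  qed (use k False in auto)
  then show ?thesis using False by (simp add: abs_if)
qed

text \<open>A general bilinear product lets the matrix equation and the vector equation share one
  existence and one uniqueness proof.\<close>

lemma linear_ode_local_bound:
  fixes mul :: "'a::real_normed_vector \<Rightarrow> 'b::real_normed_vector \<Rightarrow> 'b"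
  assumes mul: "bounded_bilinear mul" and A: "continuous_on {p..q::real} A"
  obtains M where "M > 0" "\<And>u y. u \<in> {p..q} \<Longrightarrow> norm (mul (A u) y) \<le> M * norm y"
proof -
  obtain K where K: "K > 0" "\<And>a b. norm (mul a b) \<le> norm a * norm b * K"
    using bounded_bilinear.pos_bounded[OF mul] by blast
  obtain B where B: "B > 0" "\<And>u. u \<in> {p..q} \<Longrightarrow> norm (A u) \<le> B"
    using compact_imp_bounded[OF compact_continuous_image[OF A compact_Icc]]
    by (auto simp: bounded_pos)
  have "norm (mul (A u) y) \<le> (B * K) * norm y" if "u \<in> {p..q}" for u y
  proof -
    have "norm (mul (A u) y) \<le> norm (A u) * norm y * K" by (rule K)
    also have "\<dots> \<le> B * norm y * K"
      using B(2)[OF that] K(1) by (intro mult_right_mono) auto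
    finally show ?thesis by (simp add: mult_ac)
  qed
  then show thesis using that[of "B * K"] K B by simp
qed

text \<open>Picard iteration: with the weight \<open>exp (2 M |t - s|)\<close> every step halves the size of the
  increment, so the series of increments converges locally uniformly.\<close>

lemma linear_ode_exists:
  fixes mul :: "'a::real_normed_vector \<Rightarrow> 'b::euclidean_space \<Rightarrow> 'b"
  assumes mul: "bounded_bilinear mul" and A: "continuous_on (einterval l r) A"
    and s: "s \<in> einterval l r"
  shows "\<exists>y. y s = y0 \<and> (\<forall>t\<in>einterval l r. (y has_vector_derivative mul (A t) (y t)) (at t))"
proof -
  let ?J = "einterval l r"
  interpret mul: bounded_bilinear mul by (rule mul)
  \<comment> \<open>With continuity as a premise under the quantifier, the axiom of choice yields a
    single antiderivative operator defined on all functions.\<close>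
  have "\<exists>F. continuous_on ?J f \<longrightarrow>
      F s = 0 \<and> (\<forall>t\<in>?J. (F has_vector_derivative f t) (at t))" for f :: "real \<Rightarrow> 'b"
    using ex_antiderivative_einterval[OF _ s, of f] by metis
  then obtain prim :: "(real \<Rightarrow> 'b) \<Rightarrow> real \<Rightarrow> 'b" where prim_all:
    "\<forall>f. continuous_on ?J f \<longrightarrow>
      prim f s = 0 \<and> (\<forall>t\<in>?J. (prim f has_vector_derivative f t) (at t))"
    using choice[of "\<lambda>f F. continuous_on ?J f \<longrightarrow>
      F s = 0 \<and> (\<forall>t\<in>?J. (F has_vector_derivative f t) (at t))"] by auto
  then have prim:
    "\<And>f. continuous_on ?J f \<Longrightarrow> prim f s = 0"
    "\<And>f t. continuous_on ?J f \<Longrightarrow> t \<in> ?J \<Longrightarrow> (prim f has_vector_derivative f t) (at t)"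
    by auto
  \<comment> \<open>\<open>Y k\<close> is the \<open>k\<close>-th increment of the Picard iteration:
    each one integrates the equation applied to its predecessor, and the solution is the sum of all
    of them.\<close>
  define Y where "Y = rec_nat (\<lambda>_. y0) (\<lambda>_ y. prim (\<lambda>t. mul (A t) (y t)))"
  have Y0: "Y 0 = (\<lambda>_. y0)" and YSuc: "Y (Suc k) = prim (\<lambda>t. mul (A t) (Y k t))" for k
    by (simp_all add: Y_def)
  define Y' where "Y' k t = (case k of 0 \<Rightarrow> 0 | Suc j \<Rightarrow> mul (A t) (Y j t))" for k t
  have contY: "continuous_on ?J (Y k)" for k
  proof (induction k)
    case 0 show ?case by (simp add: Y0)
  next
    case (Suc k)
    have "continuous_on ?J (\<lambda>t. mul (A t) (Y k t))"
      by (intro mul.continuous_on A Suc)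
    from prim(2)[OF this] show ?case
      unfolding YSuc by (auto intro!: continuous_at_imp_continuous_on has_vector_derivative_continuous)
  qed
  have cont: "continuous_on ?J (\<lambda>t. mul (A t) (Y k t))" for k
    by (intro mul.continuous_on A contY)
  have dY: "(Y k has_vector_derivative Y' k t) (at t)" if "t \<in> ?J" for k t
    using prim(2)[OF cont that] by (cases k) (simp_all add: Y0 YSuc Y'_def)
  have Ys: "Y (Suc k) s = 0" for k
    using prim(1)[OF cont] by (simp add: YSuc)
  define X where "X t = (\<Sum>k. Y k t)" for t
  have main: "(X has_vector_derivative mul (A t) (X t)) (at t)" if t: "t \<in> ?J" for t
  proof -
    obtain p q where pq: "p < s" "p < t" "s < q" "t < q" "{p..q} \<subseteq> ?J"
      using einterval_neighbourhood[OF s t] by blast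
    obtain M where M: "M > 0" "\<And>u y. u \<in> {p..q} \<Longrightarrow> norm (mul (A u) y) \<le> M * norm y"
      using linear_ode_local_bound[OF mul continuous_on_subset[OF A pq(5)]] by blast
    have Yb: "norm (Y k u) \<le> norm y0 * (1/2) ^ k * exp (2 * M * \<bar>u - s\<bar>)"
      if "u \<in> {p..q}" for k u
      using that
    proof (induction k arbitrary: u)
      case 0
      have "norm y0 * 1 \<le> norm y0 * exp (2 * M * \<bar>u - s\<bar>)"
        using M by (intro mult_left_mono) auto
      then show ?case by (simp add: Y0)
    next
      case (Suc k)
      \<comment> \<open>The increment bound is applied with rate \<open>2 * M\<close>, while the
        derivative of \<open>Y (Suc k)\<close> is at most \<open>M\<close> times \<open>Y k\<close>;
        the quotient \<open>M / (2 * M)\<close> is the factor one half.\<close>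
      have "norm (Y (Suc k) u - Y (Suc k) s)
          \<le> M * (norm y0 * (1/2) ^ k) / (2 * M) * exp (2 * M * \<bar>u - s\<bar>)"
      proof (rule exponential_increment_bound[where f = "Y' (Suc k)"])
        show "(Y (Suc k) has_vector_derivative Y' (Suc k) v) (at v)" if "v \<in> {p..q}" for v
          using dY pq(5) that by blast
        show "norm (Y' (Suc k) v) \<le> M * (norm y0 * (1/2) ^ k) * exp (2 * M * \<bar>v - s\<bar>)"
          if "v \<in> {p..q}" for v
        proof -
          have "norm (Y' (Suc k) v) \<le> M * norm (Y k v)" using M(2)[OF that] by (simp add: Y'_def)
          also have "\<dots> \<le> M * (norm y0 * (1/2) ^ k * exp (2 * M * \<bar>v - s\<bar>))"
            using Suc.IH[OF that] M by (intro mult_left_mono) auto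
          finally show ?thesis by (simp add: mult_ac)
        qed
      qed (use M pq Suc.prems in auto)
      then show ?case using M by (simp add: Ys mult_ac)
    qed
    define C where "C = norm y0 * exp (2 * M * (q - p))"
    have YC: "norm (Y k u) \<le> C * (1/2) ^ k" if "u \<in> {p..q}" for k u
    proof -
      have "norm (Y k u) \<le> norm y0 * (1/2) ^ k * exp (2 * M * \<bar>u - s\<bar>)" using Yb[OF that] .
      also have "\<dots> \<le> norm y0 * (1/2) ^ k * exp (2 * M * (q - p))"
        using that pq M by (intro mult_left_mono) auto
      finally show ?thesis by (simp add: C_def mult_ac)
    qed
    have summ: "summable (\<lambda>k. C * (1/2::real) ^ k)"
      by (intro summable_mult summable_geometric) auto
    have ulim: "uniform_limit {p..q} (\<lambda>n u. \<Sum>k<n. Y k u) X sequentially"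
      unfolding X_def by (rule Weierstrass_m_test[OF YC summ])
    have sumsX: "(\<lambda>k. Y k u) sums X u" if "u \<in> {p..q}" for u
      using tendsto_uniform_limitI[OF ulim that] by (simp add: sums_def)
    \<comment> \<open>The derivative of \<open>Y 0\<close> vanishes, so the differentiated partial
      sums lag by one index and equal \<open>A u\<close> applied to partial sums of
      \<open>Y\<close>. Their uniform convergence follows from \<open>ulim\<close>, with tolerance
      \<open>\<epsilon> / M\<close>.\<close>
    have sumY': "(\<Sum>k<Suc n. Y' k u) = mul (A u) (\<Sum>k<n. Y k u)" for n u
      by (simp add: sum.lessThan_Suc_shift Y'_def mul.sum_right del: sum.lessThan_Suc)
    have tpq: "t \<in> {p..q}" using pq by simp
    have "\<exists>g. \<forall>x\<in>{p..q}. (\<lambda>n. Y n x) sums (g x) \<and>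
        (g has_derivative (\<lambda>h. h *\<^sub>R mul (A x) (X x))) (at x within {p..q})"
    proof (rule has_derivative_series[where f = Y and x = t and l = "X t"
          and f' = "\<lambda>n x h. h *\<^sub>R Y' n x" and g' = "\<lambda>x h. h *\<^sub>R mul (A x) (X x)"])
      show "(Y n has_derivative (\<lambda>h. h *\<^sub>R Y' n x)) (at x within {p..q})" if "x \<in> {p..q}" for n x
        using dY[of x n] pq(5) that
        by (auto simp: has_vector_derivative_def subset_iff intro: has_derivative_at_withinI)
      fix \<epsilon> :: real assume \<epsilon>: "\<epsilon> > 0"
      have "\<forall>\<^sub>F n in sequentially. \<forall>x\<in>{p..q}. dist (\<Sum>k<n. Y k x) (X x) < \<epsilon> / M"
        by (rule uniform_limitD[OF ulim]) (use \<epsilon> M in simp)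
      then have "\<forall>\<^sub>F n in sequentially. \<forall>x\<in>{p..q}. \<forall>h.
          norm ((\<Sum>k<Suc n. h *\<^sub>R Y' k x) - h *\<^sub>R mul (A x) (X x)) \<le> \<epsilon> * norm h"
      proof eventually_elim
        case (elim n)
        show ?case
        proof (intro ballI allI)
          fix x h assume x: "x \<in> {p..q}"
          have "norm ((\<Sum>k<Suc n. h *\<^sub>R Y' k x) - h *\<^sub>R mul (A x) (X x))
              = \<bar>h\<bar> * norm (mul (A x) ((\<Sum>k<n. Y k x) - X x))"
            unfolding scaleR_sum_right[symmetric] sumY' mul.diff_right
            by (simp add: scaleR_diff_right[symmetric])
          also have "\<dots> \<le> \<bar>h\<bar> * (M * norm ((\<Sum>k<n. Y k x) - X x))"
            by (intro mult_left_mono M(2) x) simp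
          also have "\<dots> \<le> \<bar>h\<bar> * (M * (\<epsilon> / M))"
            using elim x M by (intro mult_left_mono) (auto simp: dist_norm less_imp_le)
          finally show "norm ((\<Sum>k<Suc n. h *\<^sub>R Y' k x) - h *\<^sub>R mul (A x) (X x)) \<le> \<epsilon> * norm h"
            using M by (simp add: mult_ac)
        qed
      qed
      then show "\<forall>\<^sub>F n in sequentially. \<forall>x\<in>{p..q}. \<forall>h.
          norm ((\<Sum>k<n. h *\<^sub>R Y' k x) - h *\<^sub>R mul (A x) (X x)) \<le> \<epsilon> * norm h"
        by (subst (asm) eventually_sequentially_Suc)
    qed (use tpq sumsX[OF tpq] in auto)
    then obtain g where g: "\<And>x. x \<in> {p..q} \<Longrightarrow> (\<lambda>n. Y n x) sums g x"
        "\<And>x. x \<in> {p..q} \<Longrightarrow>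
          (g has_derivative (\<lambda>h. h *\<^sub>R mul (A x) (X x))) (at x within {p..q})"
      by blast
    have gX: "g x = X x" if "x \<in> {p..q}" for x
      using sums_unique2[OF g(1)[OF that] sumsX[OF that]] .
    have "(X has_vector_derivative mul (A t) (X t)) (at t within {p..q})"
      using g(2)[OF tpq] unfolding has_vector_derivative_def
      by (rule has_derivative_transform[OF tpq, rotated]) (use gX in simp)
    then show ?thesis
      using pq by (simp add: at_within_Icc_at)
  qed
  have "X s = y0"
  proof -
    \<comment> \<open>At the base point only the term \<open>Y 0\<close> survives.\<close>
    have "(\<lambda>k. Y k s) sums (\<Sum>k\<in>{0}. Y k s)"
      by (rule sums_finite) (auto simp: gr0_conv_Suc Ys)
    then show ?thesis by (simp add: X_def sums_iff Y0)
  qed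
  with main show ?thesis by blast
qed

section \<open>Uniqueness of solutions\<close>

text \<open>The energy \<open>y u \<bullet> y u\<close> grows at rate at most \<open>2 * M\<close>
  by Cauchy-Schwarz. Multiplied by \<open>exp (- (2 * M) * u)\<close> it is therefore nonincreasing,
  and it starts at 0.\<close>

lemma linear_growth_zero_right:
  fixes y :: "real \<Rightarrow> 'b::real_inner"
  assumes y: "\<And>u. s \<le> u \<Longrightarrow> u \<le> t \<Longrightarrow> (y has_vector_derivative y' u) (at u)"
    and bound: "\<And>u. s \<le> u \<Longrightarrow> u \<le> t \<Longrightarrow> norm (y' u) \<le> M * norm (y u)"
    and "y s = 0" "s \<le> t"
  shows "y t = 0"
proof -
  let ?f = "\<lambda>u. (y u \<bullet> y u) * exp (- (2 * M) * u)"
  have "?f t \<le> ?f s"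
  proof (rule DERIV_nonpos_imp_nonincreasing[OF \<open>s \<le> t\<close>])
    fix u assume u: "s \<le> u" "u \<le> t"
    let ?D = "(2 * (y u \<bullet> y' u) - 2 * M * (y u \<bullet> y u)) * exp (- (2 * M) * u)"
    have "((\<lambda>u. y u \<bullet> y u) has_real_derivative 2 * (y u \<bullet> y' u)) (at u)"
      using has_derivative_inner[OF y[OF u, unfolded has_vector_derivative_def]
          y[OF u, unfolded has_vector_derivative_def]]
      by (simp add: has_field_derivative_def inner_commute algebra_simps)
         (simp add: mult_commute_abs algebra_simps)
    then have "(?f has_real_derivative ?D) (at u)"
      by (auto intro!: derivative_eq_intros simp: algebra_simps)
    moreover have "y u \<bullet> y' u \<le> M * (y u \<bullet> y u)"
    proof -
      have "y u \<bullet> y' u \<le> norm (y u) * norm (y' u)" by (rule norm_cauchy_schwarz)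
      also have "\<dots> \<le> norm (y u) * (M * norm (y u))"
        by (intro mult_left_mono bound u) auto
      finally show ?thesis by (simp add: dot_square_norm power2_eq_square mult_ac)
    qed
    then have "?D \<le> 0" by (intro mult_nonpos_nonneg) auto
    ultimately show "\<exists>d. (?f has_real_derivative d) (at u) \<and> d \<le> 0" by blast
  qed
  then have "y t \<bullet> y t \<le> 0" using \<open>y s = 0\<close> by (simp add: mult_le_0_iff)
  then show ?thesis by (metis inner_eq_zero_iff inner_ge_zero order_antisym)
qed

lemma linear_growth_zero:
  fixes y :: "real \<Rightarrow> 'b::real_inner"
  assumes y: "\<And>u. u \<in> {p..q} \<Longrightarrow> (y has_vector_derivative y' u) (at u)"
    and bound: "\<And>u. u \<in> {p..q} \<Longrightarrow> norm (y' u) \<le> M * norm (y u)"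
    and "y s = 0" and st: "s \<in> {p..q}" "t \<in> {p..q}"
  shows "y t = 0"
proof (cases "s \<le> t")
  case True
  then show ?thesis
    by (intro linear_growth_zero_right[of s t y y' M]) (use y bound st \<open>y s = 0\<close> in auto)
next
  case False
  have "(y \<circ> uminus) (- t) = 0"
  proof (rule linear_growth_zero_right[of "- s" _ _ "\<lambda>u. - y' (- u)" M])
    fix u assume u: "- s \<le> u" "u \<le> - t"
    then have mem: "- u \<in> {p..q}" using st by auto
    have "((y \<circ> uminus) has_vector_derivative (- 1) *\<^sub>R y' (- u)) (at u)"
      by (rule vector_diff_chain_at) (auto intro!: derivative_eq_intros y[OF mem])
    then show "((y \<circ> uminus) has_vector_derivative - y' (- u)) (at u)" by simp
    show "norm (- y' (- u)) \<le> M * norm ((y \<circ> uminus) u)" using bound[OF mem] by simp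
  qed (use False \<open>y s = 0\<close> in auto)
  then show ?thesis by simp
qed

lemma linear_ode_unique:
  fixes mul :: "'a::real_normed_vector \<Rightarrow> 'b::real_inner \<Rightarrow> 'b"
  assumes mul: "bounded_bilinear mul" and A: "continuous_on (einterval l r) A"
    and s: "s \<in> einterval l r" and t: "t \<in> einterval l r"
    and y: "\<And>u. u \<in> einterval l r \<Longrightarrow> (y has_vector_derivative mul (A u) (y u)) (at u)"
    and z: "\<And>u. u \<in> einterval l r \<Longrightarrow> (z has_vector_derivative mul (A u) (z u)) (at u)"
    and eq: "y s = z s"
  shows "y t = z t"
proof -
  interpret mul: bounded_bilinear mul by (rule mul)
  obtain p q where pq: "p < s" "p < t" "s < q" "t < q" "{p..q} \<subseteq> einterval l r"
    using einterval_neighbourhood[OF s t] by blast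
  obtain M where M: "\<And>u y. u \<in> {p..q} \<Longrightarrow> norm (mul (A u) y) \<le> M * norm y"
    using linear_ode_local_bound[OF mul continuous_on_subset[OF A pq(5)]] by metis
  have "y t - z t = 0"
  proof (rule linear_growth_zero[where p = p and q = q and s = s and t = t])
    show "((\<lambda>u. y u - z u) has_vector_derivative mul (A u) (y u - z u)) (at u)"
      if "u \<in> {p..q}" for u
      using pq(5) that unfolding mul.diff_right by (intro derivative_intros y z) auto
    show "norm (mul (A u) (y u - z u)) \<le> M * norm (y u - z u)" if "u \<in> {p..q}" for u
      using M[OF that] .
  qed (use pq eq in auto)
  then show ?thesis by simp
qed

section \<open>Matrix products as bounded bilinear maps\<close>

lemma bounded_bilinear_matrix_mult:
  "bounded_bilinear ((**) :: real^'n^'n \<Rightarrow> real^'n^'n \<Rightarrow> real^'n^'n)"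
  unfolding bilinear_conv_bounded_bilinear[symmetric] bilinear_def linear_iff
  by (auto simp: matrix_add_ldistrib matrix_scalar_ac scalar_matrix_assoc matrix_eq
      matrix_vector_mul_assoc[symmetric] matrix_vector_mult_add_rdistrib
      scaleR_matrix_vector_assoc[symmetric])

lemma bounded_bilinear_matrix_vector_mult:
  "bounded_bilinear ((*v) :: real^'n^'n \<Rightarrow> real^'n \<Rightarrow> real^'n)"
  unfolding bilinear_conv_bounded_bilinear[symmetric] bilinear_def linear_iff
  by (auto simp: matrix_vector_right_distrib matrix_vector_mult_scaleR
      matrix_vector_mult_add_rdistrib scaleR_matrix_vector_assoc)

interpretation matrix_mult: bounded_bilinear "(**) :: real^'n^'n \<Rightarrow> real^'n^'n \<Rightarrow> real^'n^'n"
  by (rule bounded_bilinear_matrix_mult)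

interpretation matrix_vector_mult: bounded_bilinear "(*v) :: real^'n^'n \<Rightarrow> real^'n \<Rightarrow> real^'n"
  by (rule bounded_bilinear_matrix_vector_mult)

lemma open_halfline_eq_einterval: "open_halfline a\<^sub>0 = einterval a\<^sub>0 \<infinity>"
  by (auto simp: open_halfline_def einterval_def)

subsection \<open>Transition matrices\<close>

locale halfline_system =
  fixes a\<^sub>0 :: ereal and A :: "real \<Rightarrow> real ^ 'n ^ 'n"
  assumes continuous: "continuous_on (open_halfline a\<^sub>0) A"
begin

abbreviation "J \<equiv> open_halfline a\<^sub>0"
abbreviation "\<Phi> \<equiv> transition_matrix J A"

lemma open_J: "open J"
  by (simp add: open_halfline_eq_einterval)

lemma continuous_einterval: "continuous_on (einterval a\<^sub>0 \<infinity>) A"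
  using continuous by (simp add: open_halfline_eq_einterval)

lemma matrix_solution_unique:
  fixes X Y :: "real \<Rightarrow> real ^ 'n ^ 'n"
  assumes "s \<in> J" "t \<in> J"
    and "\<And>u. u \<in> J \<Longrightarrow> (X has_vector_derivative A u ** X u) (at u)"
    and "\<And>u. u \<in> J \<Longrightarrow> (Y has_vector_derivative A u ** Y u) (at u)"
    and "X s = Y s"
  shows "X t = Y t"
  using linear_ode_unique[OF bounded_bilinear_matrix_mult continuous_einterval, of s t X Y] assms
  by (simp add: open_halfline_eq_einterval)

text \<open>Uniqueness of matrix solutions discharges the definite description. Since
  \<open>J\<close> is open, derivatives within \<open>J\<close> are derivatives in the full
  sense.\<close>

lemma transition_matrix_eq:
  assumes "s \<in> J" "t \<in> J"
    and X: "\<And>u. u \<in> J \<Longrightarrow> (X has_vector_derivative A u ** X u) (at u)" and "X s = mat 1"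
  shows "\<Phi> t s = X t"
  unfolding transition_matrix_def
proof (rule the_equality)
  show "\<exists>X'. (\<forall>u\<in>J. (X' has_vector_derivative A u ** X' u) (at u within J)) \<and>
      X' s = mat 1 \<and> X' t = X t"
    using X \<open>X s = mat 1\<close> by (blast intro: has_vector_derivative_at_within)
next
  fix M
  assume "\<exists>Y. (\<forall>u\<in>J. (Y has_vector_derivative A u ** Y u) (at u within J)) \<and>
      Y s = mat 1 \<and> Y t = M"
  then obtain Y where Y: "\<forall>u\<in>J. (Y has_vector_derivative A u ** Y u) (at u within J)"
    "Y s = mat 1" "Y t = M" by blast
  have "Y t = X t"
    by (rule matrix_solution_unique[OF assms(1,2)])
       (use Y X \<open>X s = mat 1\<close> in \<open>auto simp: at_within_open[OF _ open_J]\<close>)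
  then show "M = X t" using Y by simp
qed

lemma
  assumes s: "s \<in> J"
  shows transition_matrix_self: "\<Phi> s s = mat 1"
    and transition_matrix_has_derivative:
      "\<And>t. t \<in> J \<Longrightarrow> ((\<lambda>u. \<Phi> u s) has_vector_derivative A t ** \<Phi> t s) (at t)"
proof -
  obtain X where X: "X s = mat 1" "\<And>u. u \<in> J \<Longrightarrow> (X has_vector_derivative A u ** X u) (at u)"
    using linear_ode_exists[OF bounded_bilinear_matrix_mult continuous_einterval, of s "mat 1"] s
    by (auto simp: open_halfline_eq_einterval)
  have eq: "\<Phi> t s = X t" if "t \<in> J" for t
    by (rule transition_matrix_eq[OF s that]) (use X in auto)
  show "\<Phi> s s = mat 1" using eq[OF s] X by simp
  show "((\<lambda>u. \<Phi> u s) has_vector_derivative A t ** \<Phi> t s) (at t)" if t: "t \<in> J" for t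
  proof (rule has_vector_derivative_transform_within_open[OF _ open_J t])
    show "(X has_vector_derivative A t ** \<Phi> t s) (at t)" using X(2)[OF t] eq[OF t] by simp
  qed (simp add: eq)
qed

text \<open>As functions of \<open>t\<close>, both sides solve the same matrix equation and agree at
  \<open>t = r\<close>.\<close>

lemma transition_matrix_cocycle:
  assumes "r \<in> J" "s \<in> J" "t \<in> J"
  shows "\<Phi> t r ** \<Phi> r s = \<Phi> t s"
proof (rule matrix_solution_unique[OF \<open>r \<in> J\<close> \<open>t \<in> J\<close>, where X = "\<lambda>t. \<Phi> t r ** \<Phi> r s"])
  fix u assume u: "u \<in> J"
  have "((\<lambda>t. \<Phi> t r ** \<Phi> r s) has_vector_derivative (A u ** \<Phi> u r) ** \<Phi> r s) (at u)"
    by (rule bounded_linear.has_vector_derivative[OF matrix_mult.bounded_linear_left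
          transition_matrix_has_derivative[OF \<open>r \<in> J\<close> u]])
  then show "((\<lambda>t. \<Phi> t r ** \<Phi> r s) has_vector_derivative A u ** (\<Phi> u r ** \<Phi> r s)) (at u)"
    by (simp add: matrix_mul_assoc)
qed (use assms in \<open>simp_all add: transition_matrix_self transition_matrix_has_derivative\<close>)

lemma solves_linear_system_transition:
  assumes s: "s \<in> J"
  shows "solves_linear_system J A (\<lambda>t. \<Phi> t s *v v)"
  unfolding solves_linear_system_def
proof
  fix t assume t: "t \<in> J"
  have "((\<lambda>t. \<Phi> t s *v v) has_vector_derivative (A t ** \<Phi> t s) *v v) (at t)"
    by (rule bounded_linear.has_vector_derivative[OF matrix_vector_mult.bounded_linear_left
          transition_matrix_has_derivative[OF s t]])
  then show "((\<lambda>t. \<Phi> t s *v v) has_vector_derivative A t *v (\<Phi> t s *v v)) (at t within J)"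
    by (simp add: matrix_vector_mul_assoc has_vector_derivative_at_within)
qed

lemma solution_eq_transition:
  assumes x: "solves_linear_system J A x" and s: "s \<in> J" and t: "t \<in> J"
  shows "x t = \<Phi> t s *v x s"
proof -
  have "(y has_vector_derivative A u *v y u) (at u)"
    if "solves_linear_system J A y" "u \<in> einterval a\<^sub>0 \<infinity>" for y u
    using that by (auto simp: solves_linear_system_def open_halfline_eq_einterval
        at_within_open[OF _ open_einterval])
  from this[OF x] this[OF solves_linear_system_transition[OF s, of "x s"]]
  show ?thesis
    using s t by (intro linear_ode_unique[OF bounded_bilinear_matrix_vector_mult
        continuous_einterval, of s t x])
      (simp_all add: open_halfline_eq_einterval[symmetric] transition_matrix_self)
qed

end

subsection \<open>Induced matrix norms\<close>

locale norm_on_vectors =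
  fixes N :: "real ^ 'n \<Rightarrow> real"
  assumes is_norm: "is_norm N"
begin

abbreviation "nrm \<equiv> induced_norm N"

lemma N_eq_0_iff: "N x = 0 \<longleftrightarrow> x = 0"
  and N_scale: "N (c *\<^sub>R x) = \<bar>c\<bar> * N x"
  and N_triangle: "N (x + y) \<le> N x + N y"
  using is_norm by (auto simp: is_norm_def)

lemma N_zero [simp]: "N 0 = 0"
  by (simp add: N_eq_0_iff)

lemma N_minus [simp]: "N (- x) = N x"
  using N_scale[of "-1" x] by simp

lemma N_nonneg [simp]: "0 \<le> N x"
  using N_triangle[of x "- x"] by simp

lemma N_pos: "x \<noteq> 0 \<Longrightarrow> 0 < N x"
  using N_nonneg[of x] N_eq_0_iff[of x] by linarith

lemma N_diff: "N (x - y) \<le> N x + N y"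
  using N_triangle[of x "- y"] by simp

text \<open>A norm is convex, and a finite convex function on a finite-dimensional space is
  continuous.\<close>

lemma continuous_on_N: "continuous_on S N"
proof -
  have "convex_on UNIV N"
  proof (rule convex_onI)
    fix t x y assume t: "0 < (t::real)" "t < 1"
    have "N ((1 - t) *\<^sub>R x + t *\<^sub>R y) \<le> N ((1 - t) *\<^sub>R x) + N (t *\<^sub>R y)" by (rule N_triangle)
    then show "N ((1 - t) *\<^sub>R x + t *\<^sub>R y) \<le> (1 - t) * N x + t * N y"
      using t by (simp add: N_scale)
  qed simp
  then show ?thesis
    using convex_on_continuous[OF open_UNIV] continuous_on_subset by blast
qed

text \<open>The quotient is invariant under scaling of \<open>x\<close>, so it suffices to bound it
  on the compact Euclidean unit sphere. Without this bound the supremum in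
  \<open>induced_norm\<close> would carry no information.\<close>

lemma N_matrix_bounded: "bdd_above (range (\<lambda>x. N (M *v x) / N x))"
proof -
  let ?q = "\<lambda>x. N (M *v x) / N x" and ?S = "sphere (0 :: real ^ 'n) 1"
  have "continuous_on ?S (N \<circ> (*v) M)"
    by (intro continuous_on_compose linear_continuous_on matrix_vector_mult.bounded_linear_right
        continuous_on_N)
  then have "continuous_on ?S ?q"
    by (intro continuous_on_divide continuous_on_N) (auto simp: o_def N_eq_0_iff)
  then have "compact (?q ` ?S)"
    by (rule compact_continuous_image) (rule compact_sphere)
  then obtain B where B: "\<And>x. x \<in> ?S \<Longrightarrow> ?q x \<le> B"
    using bounded_imp_bdd_above[OF compact_imp_bounded, of "?q ` ?S"] unfolding bdd_above_def
    by (metis imageI)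
  \<comment> \<open>The 0 covers \<open>x = 0\<close>, where the quotient is
    \<open>0 / 0 = 0\<close>.\<close>
  have "?q x \<le> max B 0" for x
  proof (cases "x = 0")
    case False
    define y where "y = x /\<^sub>R norm x"
    have "y \<in> ?S" "x = norm x *\<^sub>R y" using False by (auto simp: y_def)
    then have "?q x = ?q y"
      using False by (metis N_scale abs_norm_cancel matrix_vector_mult_scaleR
          mult_divide_mult_cancel_left norm_eq_zero)
    then show ?thesis using B[OF \<open>y \<in> ?S\<close>] by simp
  qed simp
  then show ?thesis by (auto simp: bdd_above_def)
qed

lemma N_matrix_le: "N (M *v x) \<le> nrm M * N x"
proof (cases "x = 0")
  case False
  have "N (M *v x) / N x \<le> nrm M"
    unfolding induced_norm_def by (rule cSUP_upper[OF UNIV_I N_matrix_bounded])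
  then show ?thesis using N_pos[OF False] by (simp add: field_simps)
qed simp

lemma nrm_nonneg [simp]: "0 \<le> nrm M"
proof -
  have "N (M *v 0) / N 0 \<le> nrm M"
    unfolding induced_norm_def by (rule cSUP_upper[OF UNIV_I N_matrix_bounded])
  then show ?thesis by simp
qed

lemma nrm_leI:
  assumes "0 \<le> c" "\<And>x. N (M *v x) \<le> c * N x"
  shows "nrm M \<le> c"
  unfolding induced_norm_def
proof (rule cSUP_least)
  fix x
  show "N (M *v x) / N x \<le> c"
    using assms(2)[of x] N_pos[of x] \<open>0 \<le> c\<close> by (cases "x = 0") (auto simp: divide_le_eq)
qed simp

lemma nrm_mult: "nrm (M ** M') \<le> nrm M * nrm M'"
proof (rule nrm_leI)
  fix x
  have "N ((M ** M') *v x) \<le> nrm M * N (M' *v x)"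
    using N_matrix_le[of M "M' *v x"] by (simp add: matrix_vector_mul_assoc)
  also have "\<dots> \<le> nrm M * (nrm M' * N x)" by (intro mult_left_mono N_matrix_le) simp
  finally show "N ((M ** M') *v x) \<le> nrm M * nrm M' * N x" by (simp add: mult_ac)
qed simp

lemma nrm_mult_le:
  assumes "nrm M \<le> c" "nrm M' \<le> d"
  shows "nrm (M ** M') \<le> c * d"
proof -
  have "nrm M * nrm M' \<le> c * d"
    using assms order_trans[OF nrm_nonneg assms(1)] by (intro mult_mono) auto
  then show ?thesis using nrm_mult[of M M'] by linarith
qed

lemma nrm_add: "nrm (M + M') \<le> nrm M + nrm M'"
proof (rule nrm_leI)
  fix x
  show "N ((M + M') *v x) \<le> (nrm M + nrm M') * N x"
    using N_triangle[of "M *v x" "M' *v x"] N_matrix_le[of M x] N_matrix_le[of M' x]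
    by (simp add: matrix_vector_mult_add_rdistrib distrib_right)
qed simp

lemma nrm_diff: "nrm (M - M') \<le> nrm M + nrm M'"
proof (rule nrm_leI)
  fix x
  show "N ((M - M') *v x) \<le> (nrm M + nrm M') * N x"
    using N_diff[of "M *v x" "M' *v x"] N_matrix_le[of M x] N_matrix_le[of M' x]
    by (simp add: matrix_vector_mult_diff_rdistrib distrib_right)
qed simp

lemma nrm_id: "nrm (mat 1) \<le> 1"
  by (rule nrm_leI) simp_all

end

subsection \<open>Projectors and direct sums\<close>

text \<open>Every \<open>x\<close> splits as \<open>P *v x\<close> plus \<open>x - P *v x\<close>.
  At the time \<open>e\<close> this is the vanishing of the index of a dichotomy on all of
  \<open>J\<close>.\<close>

lemma projector_range_kernel_dim:
  fixes P :: "real ^ 'n ^ 'n"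
  assumes "P ** P = P"
  shows "dim (range ((*v) P)) + dim {x. P *v x = 0} = CARD('n)"
proof -
  let ?R = "range ((*v) P)" and ?K = "{x. P *v x = 0}"
  have PP: "P *v (P *v x) = P *v x" for x using assms by (simp add: matrix_vector_mul_assoc)
  have R: "subspace ?R" and K: "subspace ?K"
    by (auto intro!: linear_subspace_image linear_subspace_kernel)
  have "x \<in> {x + y |x y. x \<in> ?R \<and> y \<in> ?K}" for x
    by (rule CollectI, rule exI[of _ "P *v x"], rule exI[of _ "x - P *v x"])
       (simp add: matrix_vector_mult_diff_distrib PP)
  then have "{x + y |x y. x \<in> ?R \<and> y \<in> ?K} = UNIV" by blast
  moreover have "?R \<inter> ?K = {0}" using PP by (auto simp: image_iff intro!: exI[of _ 0])
  ultimately show ?thesis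
    using dim_sums_Int[OF R K] by simp
qed

text \<open>By the dimension formula the sum of the two subspaces is the whole space. The third
  property, uniqueness of the component in \<open>R\<close>, later yields the identities between
  \<open>Q\<close> and the given projectors.\<close>

lemma ex_projector_along_complement:
  fixes R K :: "(real ^ 'n) set"
  assumes R: "subspace R" and K: "subspace K"
    and RK: "R \<inter> K = {0}" and dim: "dim R + dim K = CARD('n)"
  obtains Q :: "real ^ 'n ^ 'n"
  where "\<And>x. Q *v x \<in> R" "\<And>x. x - Q *v x \<in> K" "\<And>x r. r \<in> R \<Longrightarrow> x - r \<in> K \<Longrightarrow> Q *v x = r"
proof -
  have "dim {x + y |x y. x \<in> R \<and> y \<in> K} = DIM(real ^ 'n)"
    using dim_sums_Int[OF R K] RK dim by simp
  then have "{x + y |x y. x \<in> R \<and> y \<in> K} = UNIV"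
    using dim_eq_full[of "{x + y |x y. x \<in> R \<and> y \<in> K}"] span_eq_iff[of "{x + y |x y. x \<in> R \<and> y \<in> K}"]
      subspace_sums[OF R K] by simp
  then have "\<exists>r k. x = r + k \<and> r \<in> R \<and> k \<in> K" for x by blast
  then have "\<exists>r. r \<in> R \<and> x - r \<in> K" for x by (metis add_diff_cancel_left')
  then obtain q where q: "\<And>x. q x \<in> R" "\<And>x. x - q x \<in> K" by metis
  have unique: "q x = r" if "r \<in> R" "x - r \<in> K" for x r
  proof -
    have "q x - r \<in> R" using q that R by (simp add: subspace_diff)
    moreover have "(x - r) - (x - q x) \<in> K" using q that K by (metis subspace_diff)
    then have "q x - r \<in> K" by simp
    ultimately have "q x - r \<in> R \<inter> K" by blast
    then show ?thesis by (simp add: RK)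
  qed
  have "linear q"
  proof (rule linearI)
    fix x y :: "real ^ 'n" and c :: real
    have "(x - q x) + (y - q y) \<in> K" "c *\<^sub>R (x - q x) \<in> K"
      by (rule subspace_add[OF K q(2) q(2)], rule subspace_scale[OF K q(2)])
    then have "x + y - (q x + q y) \<in> K" "c *\<^sub>R x - c *\<^sub>R q x \<in> K"
      by (simp_all add: algebra_simps)
    then show "q (x + y) = q x + q y" "q (c *\<^sub>R x) = c *\<^sub>R q x"
      by (auto intro: unique subspace_add[OF R q(1) q(1)] subspace_scale[OF R q(1)])
  qed
  then have "matrix q *v x = q x" for x by (metis matrix_vector_mul)
  then show thesis using that[of "matrix q"] q unique by simp
qed

subsection \<open>Dichotomies\<close>

locale dichotomy_setting = halfline_system a\<^sub>0 A + norm_on_vectors N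
  for a\<^sub>0 :: ereal and A :: "real \<Rightarrow> real ^ 'n ^ 'n" and N :: "real ^ 'n \<Rightarrow> real" +
  fixes h :: "real \<Rightarrow> real"
  assumes growth_rate: "growth_rate J h"
begin

definition invariant_projector :: "real set \<Rightarrow> (real \<Rightarrow> real ^ 'n ^ 'n) \<Rightarrow> bool" where
  "invariant_projector I P \<longleftrightarrow>
     (\<forall>t\<in>I. P t ** P t = P t) \<and> (\<forall>t\<in>I. \<forall>s\<in>I. P t ** \<Phi> t s = \<Phi> t s ** P s)"

text \<open>The constants are explicit parameters so that both half-lines can be given the same
  ones.\<close>

definition estimates :: "real set \<Rightarrow> (real \<Rightarrow> real ^ 'n ^ 'n) \<Rightarrow> real \<Rightarrow> real \<Rightarrow> bool" where
  "estimates I P K \<alpha> \<longleftrightarrow>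
     (\<forall>t\<in>I. \<forall>s\<in>I. t \<ge> s \<longrightarrow> nrm (\<Phi> t s ** P s) \<le> K * (h t / h s) powr (- \<alpha>)) \<and>
     (\<forall>t\<in>I. \<forall>s\<in>I. s \<ge> t \<longrightarrow> nrm (\<Phi> t s ** (mat 1 - P s)) \<le> K * (h s / h t) powr (- \<alpha>))"

lemma uniform_dichotomy_with_iff:
  "uniform_dichotomy_with N J h A I P \<longleftrightarrow>
     invariant_projector I P \<and> (\<exists>K \<alpha>. K \<ge> 1 \<and> \<alpha> > 0 \<and> estimates I P K \<alpha>)"
  by (simp add: uniform_dichotomy_with_def invariant_projector_def estimates_def)

lemma invariant_projectorD:
  assumes "invariant_projector I P" "t \<in> I"
  shows "P t ** P t = P t" and "s \<in> I \<Longrightarrow> P t ** \<Phi> t s = \<Phi> t s ** P s"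
  using assms by (auto simp: invariant_projector_def)

lemma estimatesD:
  assumes "estimates I P K \<alpha>" "t \<in> I" "s \<in> I"
  shows "s \<le> t \<Longrightarrow> nrm (\<Phi> t s ** P s) \<le> K * (h t / h s) powr (- \<alpha>)"
    and "t \<le> s \<Longrightarrow> nrm (\<Phi> t s ** (mat 1 - P s)) \<le> K * (h s / h t) powr (- \<alpha>)"
  using assms by (auto simp: estimates_def)

section \<open>The growth rate and its decay factors\<close>

lemma h_image: "h ` J = {0<..}"
  using growth_rate by (auto simp: growth_rate_def homeomorphism_def)

lemma h_pos: "t \<in> J \<Longrightarrow> 0 < h t"
  using h_image by auto

lemma h_onto: "0 < y \<Longrightarrow> \<exists>t\<in>J. h t = y"
  using h_image by (metis greaterThan_iff imageE)

lemma strict_mono_h: "strict_mono_on J h"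
  using growth_rate by (simp add: growth_rate_def)

lemma h_le_iff: "s \<in> J \<Longrightarrow> t \<in> J \<Longrightarrow> h s \<le> h t \<longleftrightarrow> s \<le> t"
  using strict_mono_on_less_eq[OF strict_mono_h] by simp

lemma ratio_ge_1: "s \<in> J \<Longrightarrow> t \<in> J \<Longrightarrow> s \<le> t \<Longrightarrow> 1 \<le> h t / h s"
  using h_le_iff h_pos by simp

lemma decay_le_1:
  assumes "s \<in> J" "t \<in> J" "s \<le> t" "0 \<le> \<alpha>"
  shows "(h t / h s) powr (- \<alpha>) \<le> 1"
  using powr_mono[of "- \<alpha>" 0 "h t / h s"] ratio_ge_1[OF assms(1-3)] assms(4) by (auto split: if_splits)

lemma decay_mult:
  assumes "r \<in> J" "s \<in> J" "t \<in> J"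
  shows "(h t / h r) powr b * (h r / h s) powr b = (h t / h s) powr b"
proof -
  have "(h t / h r) powr b * (h r / h s) powr b = ((h t / h r) * (h r / h s)) powr b"
    by (rule powr_mult[symmetric])
  then show ?thesis using assms[THEN h_pos] by simp
qed

lemma complement_invariant:
  assumes "invariant_projector I P" "t \<in> I" "s \<in> I"
  shows "(mat 1 - P t) ** \<Phi> t s = \<Phi> t s ** (mat 1 - P s)"
  using invariant_projectorD(2)[OF assms]
  by (simp add: matrix_mult.diff_left matrix_mult.diff_right)

section \<open>Restricting, weakening, changing and glueing estimates\<close>

lemma invariant_projector_subset:
  "invariant_projector I P \<Longrightarrow> I' \<subseteq> I \<Longrightarrow> invariant_projector I' P"
  by (auto simp: invariant_projector_def)

lemma estimates_subset: "estimates I P K \<alpha> \<Longrightarrow> I' \<subseteq> I \<Longrightarrow> estimates I' P K \<alpha>"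
  unfolding estimates_def by (meson subset_iff)

lemma estimates_mono:
  assumes P: "estimates I P K \<alpha>" and "I \<subseteq> J" "K \<le> K'" "\<alpha>' \<le> \<alpha>" "0 \<le> K'"
  shows "estimates I P K' \<alpha>'"
proof -
  have "K * (h t / h s) powr (- \<alpha>) \<le> K' * (h t / h s) powr (- \<alpha>')"
    if "s \<in> I" "t \<in> I" "s \<le> t" for s t
  proof (rule mult_mono)
    show "(h t / h s) powr (- \<alpha>) \<le> (h t / h s) powr (- \<alpha>')"
      using ratio_ge_1[of s t] that assms by (intro powr_mono) auto
  qed (use assms in auto)
  then show ?thesis
    using P unfolding estimates_def by (meson order_trans)
qed

text \<open>This is the case of equal times, where the transition matrix is the identity and the
  ratio of \<open>h\<close> is 1.\<close>

lemma projector_bounded: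
  assumes "estimates I P K \<alpha>" "I \<subseteq> J" "t \<in> I"
  shows "nrm (P t) \<le> K" "nrm (mat 1 - P t) \<le> K"
proof -
  have "t \<in> J" using assms by auto
  then show "nrm (P t) \<le> K" "nrm (mat 1 - P t) \<le> K"
    using estimatesD[OF assms(1,3,3)] h_pos[of t] by (simp_all add: transition_matrix_self)
qed

text \<open>The first alternative says that \<open>P t\<close> and \<open>R t\<close> have the same range, the second one that
  they have the same kernel.\<close>

lemma estimates_change_projector:
  assumes IJ: "I \<subseteq> J" and R: "invariant_projector I R" and P: "invariant_projector I P"
    and est: "estimates I R K \<alpha>" and K: "0 \<le> K"
    and M: "\<And>t. t \<in> I \<Longrightarrow> nrm (P t) \<le> M"
    and RP: "(\<forall>t\<in>I. R t ** P t = P t \<and> P t ** R t = R t) \<or>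
      (\<forall>t\<in>I. R t ** P t = R t \<and> P t ** R t = P t)"
  shows "estimates I P (K * (1 + M)) \<alpha>"
proof -
  have M1: "nrm (P t) \<le> 1 + M" "nrm (mat 1 - P t) \<le> 1 + M" if "t \<in> I" for t
    using M[OF that] nrm_diff[of "mat 1" "P t"] nrm_id by auto
  \<comment> \<open>Equal ranges give \<open>P s = R s ** P s\<close>. Equal kernels give
    \<open>P s = P s ** R s\<close>, and invariance moves the left factor to time \<open>t\<close>.
    Either way a bounded projector multiplies a term estimated by \<open>est\<close>.\<close>
  have stable: "\<Phi> t s ** P s = (\<Phi> t s ** R s) ** P s \<or> \<Phi> t s ** P s = P t ** (\<Phi> t s ** R s)"
    if "t \<in> I" "s \<in> I" for t s
    using RP that invariant_projectorD(2)[OF P that(1) that(2)] matrix_mul_assoc by metis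
  \<comment> \<open>The complements behave dually: equal ranges of the projectors mean equal kernels
    of the complements, and vice versa, so the two forms appear in the opposite order.\<close>
  have unstable: "\<Phi> t s ** (mat 1 - P s) = (mat 1 - P t) ** (\<Phi> t s ** (mat 1 - R s)) \<or>
      \<Phi> t s ** (mat 1 - P s) = (\<Phi> t s ** (mat 1 - R s)) ** (mat 1 - P s)"
    if "t \<in> I" "s \<in> I" for t s
    using RP
  proof (elim disjE)
    assume *: "\<forall>t\<in>I. R t ** P t = P t \<and> P t ** R t = R t"
    have "(mat 1 - P t) ** (\<Phi> t s ** (mat 1 - R s))
        = \<Phi> t s ** ((mat 1 - P s) ** (mat 1 - R s))"
      using complement_invariant[OF P that] by (metis matrix_mul_assoc)
    also have "(mat 1 - P s) ** (mat 1 - R s) = mat 1 - P s"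
      using * that by (simp add: matrix_mult.diff_left matrix_mult.diff_right)
    finally show ?thesis by simp
  next
    assume *: "\<forall>t\<in>I. R t ** P t = R t \<and> P t ** R t = P t"
    have "(mat 1 - R s) ** (mat 1 - P s) = mat 1 - P s"
      using * that by (simp add: matrix_mult.diff_left matrix_mult.diff_right)
    then show ?thesis by (metis matrix_mul_assoc)
  qed
  show ?thesis
    unfolding estimates_def
  proof (intro conjI ballI impI)
    fix t s assume ts: "t \<in> I" "s \<in> I" "s \<le> t"
    note bound = estimatesD(1)[OF est ts]
    show "nrm (\<Phi> t s ** P s) \<le> K * (1 + M) * (h t / h s) powr (- \<alpha>)"
      using stable[OF ts(1,2)] nrm_mult_le[OF bound M1(1)[OF ts(2)]]
        nrm_mult_le[OF M1(1)[OF ts(1)] bound] by (auto simp: mult_ac)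
  next
    fix t s assume ts: "t \<in> I" "s \<in> I" "t \<le> s"
    note bound = estimatesD(2)[OF est ts]
    show "nrm (\<Phi> t s ** (mat 1 - P s)) \<le> K * (1 + M) * (h s / h t) powr (- \<alpha>)"
      using unstable[OF ts(1,2)] nrm_mult_le[OF bound M1(2)[OF ts(2)]]
        nrm_mult_le[OF M1(2)[OF ts(1)] bound] by (auto simp: mult_ac)
  qed
qed

lemma estimates_glue:
  assumes e: "e \<in> J" and P: "invariant_projector J P" and K: "1 \<le> K"
    and left: "estimates {t \<in> J. t \<le> e} P K \<alpha>" and right: "estimates {e..} P K \<alpha>"
  shows "estimates J P (K * K) \<alpha>"
proof -
  \<comment> \<open>Pairs of times on one side of \<open>e\<close> need only \<open>K\<close>; since
    \<open>K\<close> is at least 1, the constant \<open>K * K\<close> of the crossing pairs serves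
    them too.\<close>
  have KK: "K \<le> K * K" using K by simp
  have weaken: "K * (x powr b) \<le> K * K * (x powr b)" for x b
    using KK by (intro mult_right_mono) auto
  \<comment> \<open>The flow is split at \<open>e\<close>; idempotence doubles the projector and
    invariance carries one copy to \<open>e\<close>, so that each factor lies on one side.\<close>
  have cross: "\<Phi> t s ** P s = (\<Phi> t e ** P e) ** (\<Phi> e s ** P s)"
    "\<Phi> t s ** (mat 1 - P s) = (\<Phi> t e ** (mat 1 - P e)) ** (\<Phi> e s ** (mat 1 - P s))"
    if "t \<in> J" "s \<in> J" for t s
  proof -
    have PP: "P s ** P s = P s" by (rule invariant_projectorD(1)[OF P that(2)])
    have QQ: "(mat 1 - P s) ** (mat 1 - P s) = mat 1 - P s"
      using PP by (simp add: matrix_mult.diff_left matrix_mult.diff_right)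
    have split: "\<Phi> t s = \<Phi> t e ** \<Phi> e s"
      using transition_matrix_cocycle[OF e that(2,1)] by simp
    show "\<Phi> t s ** P s = (\<Phi> t e ** P e) ** (\<Phi> e s ** P s)"
      using PP split invariant_projectorD(2)[OF P e that(2)] by (metis matrix_mul_assoc)
    show "\<Phi> t s ** (mat 1 - P s) = (\<Phi> t e ** (mat 1 - P e)) ** (\<Phi> e s ** (mat 1 - P s))"
      using QQ split complement_invariant[OF P e that(2)] by (metis matrix_mul_assoc)
  qed
  have product: "nrm (X ** Y) \<le> K * K * (h t / h s) powr b"
    if "nrm X \<le> K * (h t / h e) powr b" "nrm Y \<le> K * (h e / h s) powr b" "s \<in> J" "t \<in> J"
    for X Y s t b
    using nrm_mult_le[OF that(1,2)] decay_mult[OF e that(3,4), of b] by (simp add: mult_ac)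
  \<comment> \<open>For the unstable part time runs backwards, so the two ratios occur in the
    opposite order.\<close>
  have product': "nrm (X ** Y) \<le> K * K * (h t / h s) powr b"
    if "nrm X \<le> K * (h e / h s) powr b" "nrm Y \<le> K * (h t / h e) powr b" "s \<in> J" "t \<in> J"
    for X Y s t b
    using nrm_mult_le[OF that(1,2)] decay_mult[OF e that(3,4), of b] by (simp add: mult_ac)
  show ?thesis
    unfolding estimates_def
  proof (intro conjI ballI impI)
    fix t s assume ts: "t \<in> J" "s \<in> J" "s \<le> t"
    consider "t \<le> e" | "e \<le> s" | "s \<le> e" "e \<le> t" by linarith
    then show "nrm (\<Phi> t s ** P s) \<le> K * K * (h t / h s) powr (- \<alpha>)"
    proof cases
      case 1
      then show ?thesis
        using estimatesD(1)[OF left, of t s] ts weaken order_trans by fastforce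
    next
      case 2
      then show ?thesis
        using estimatesD(1)[OF right, of t s] ts weaken order_trans by fastforce
    next
      case 3
      then show ?thesis
        unfolding cross(1)[OF ts(1,2)]
        using estimatesD(1)[OF right, of t e] estimatesD(1)[OF left, of e s] ts e
        by (intro product) auto
    qed
  next
    fix t s assume ts: "t \<in> J" "s \<in> J" "t \<le> s"
    consider "s \<le> e" | "e \<le> t" | "t \<le> e" "e \<le> s" by linarith
    then show "nrm (\<Phi> t s ** (mat 1 - P s)) \<le> K * K * (h s / h t) powr (- \<alpha>)"
    proof cases
      case 1
      then show ?thesis
        using estimatesD(2)[OF left, of t s] ts weaken order_trans by fastforce
    next
      case 2
      then show ?thesis
        using estimatesD(2)[OF right, of t s] ts weaken order_trans by fastforce
    next
      case 3
      then show ?thesis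
        unfolding cross(2)[OF ts(1,2)]
        using estimatesD(2)[OF left, of t e] estimatesD(2)[OF right, of e s] ts e
        by (intro product') auto
    qed
  qed
qed

section \<open>Transporting a projector by the flow\<close>

definition transport :: "real \<Rightarrow> real ^ 'n ^ 'n \<Rightarrow> real \<Rightarrow> real ^ 'n ^ 'n" where
  "transport e Q t = \<Phi> t e ** Q ** \<Phi> e t"

lemma transition_matrix_inverse: "s \<in> J \<Longrightarrow> t \<in> J \<Longrightarrow> \<Phi> s t ** \<Phi> t s = mat 1"
  by (simp add: transition_matrix_cocycle transition_matrix_self)

text \<open>Conjugation by the flow is multiplicative, so algebraic relations between projectors at
  \<open>e\<close> hold between their transports at every time.\<close>

lemma transport_mult:
  assumes "e \<in> J" "t \<in> J"
  shows "transport e Q t ** transport e Q' t = transport e (Q ** Q') t"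
proof -
  have "transport e Q t ** transport e Q' t = \<Phi> t e ** Q ** (\<Phi> e t ** \<Phi> t e) ** Q' ** \<Phi> e t"
    by (simp add: transport_def matrix_mul_assoc)
  then show ?thesis
    using transition_matrix_inverse[OF assms] by (simp add: transport_def matrix_mul_assoc)
qed

lemma invariant_projector_eq_transport:
  assumes P: "invariant_projector I P" and "I \<subseteq> J" "e \<in> I" "t \<in> I"
  shows "P t = transport e (P e) t"
proof -
  have J: "e \<in> J" "t \<in> J" using assms by auto
  have "transport e (P e) t = P t ** (\<Phi> t e ** \<Phi> e t)"
    using invariant_projectorD(2)[OF P assms(4,3)] by (simp add: transport_def matrix_mul_assoc)
  then show ?thesis using transition_matrix_inverse[OF J(2,1)] by simp
qed

lemma invariant_projector_transport:
  assumes e: "e \<in> J" and Q: "Q ** Q = Q"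
  shows "invariant_projector J (transport e Q)"
  unfolding invariant_projector_def
proof (intro conjI ballI)
  fix t s assume t: "t \<in> J" and s: "s \<in> J"
  have "transport e Q t ** \<Phi> t s = \<Phi> t e ** Q ** (\<Phi> e t ** \<Phi> t s)"
    by (simp add: transport_def matrix_mul_assoc)
  also have "\<dots> = \<Phi> t e ** Q ** \<Phi> e s" using transition_matrix_cocycle[OF t s e] by simp
  also have "\<dots> = (\<Phi> t s ** \<Phi> s e) ** Q ** \<Phi> e s"
    using transition_matrix_cocycle[OF s e t] by simp
  finally show "transport e Q t ** \<Phi> t s = \<Phi> t s ** transport e Q s"
    by (simp add: transport_def matrix_mul_assoc)
qed (use e Q in \<open>simp add: transport_mult\<close>)

text \<open>If \<open>Q\<close> has the range of \<open>R e\<close>, then \<open>Q - R e = R e Q (I - R e)\<close>, and both outer factors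
  decay when they are transported to the right; dually for the kernel on the left.\<close>

lemma transport_bounded_right:
  assumes IJ: "I \<subseteq> J" and e: "e \<in> I" and R: "invariant_projector I R"
    and est: "estimates I R K \<alpha>" and \<alpha>: "0 \<le> \<alpha>" and K: "0 \<le> K"
    and Q: "R e ** Q = Q" "Q ** R e = R e" and t: "t \<in> I" "e \<le> t"
  shows "nrm (transport e Q t) \<le> K + K * nrm Q * K"
proof -
  have J: "e \<in> J" "t \<in> J" using IJ e t by auto
  have "Q = R e + R e ** Q ** (mat 1 - R e)"
    using Q by (simp add: matrix_mult.diff_right)
  then have "transport e Q t = transport e (R e) t + \<Phi> t e ** (R e ** Q ** (mat 1 - R e)) ** \<Phi> e t"
    unfolding transport_def by (metis matrix_mult.add_left matrix_mult.add_right)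
  also have "transport e (R e) t = R t"
    using invariant_projector_eq_transport[OF R IJ e t(1)] by simp
  also have "\<Phi> t e ** (R e ** Q ** (mat 1 - R e)) ** \<Phi> e t
      = (\<Phi> t e ** R e) ** Q ** (\<Phi> e t ** (mat 1 - R t))"
    using complement_invariant[OF R e t(1)] by (metis matrix_mul_assoc)
  finally have eq: "transport e Q t = R t + (\<Phi> t e ** R e) ** Q ** (\<Phi> e t ** (mat 1 - R t))" .
  \<comment> \<open>Only boundedness of the correction is needed, so its decay is discarded.\<close>
  have "K * (h t / h e) powr (- \<alpha>) \<le> K"
    using decay_le_1[OF J t(2) \<alpha>] K by (simp add: mult_left_le)
  then have "nrm (\<Phi> t e ** R e) \<le> K" "nrm (\<Phi> e t ** (mat 1 - R t)) \<le> K"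
    using estimatesD(1)[OF est t(1) e t(2)] estimatesD(2)[OF est e t(1) t(2)] by linarith+
  then have "nrm ((\<Phi> t e ** R e) ** Q ** (\<Phi> e t ** (mat 1 - R t))) \<le> K * nrm Q * K"
    by (intro nrm_mult_le order_refl)
  then show ?thesis
    unfolding eq using nrm_add projector_bounded(1)[OF est IJ t(1)]
    by (meson add_mono order_trans)
qed

text \<open>Equal kernels give \<open>Q - R e = (I - R e) Q (R e)\<close>. For
  \<open>t \<le> e\<close> the dichotomy bounds both \<open>\<Phi> t e ** (mat 1 - R e)\<close> and
  \<open>\<Phi> e t ** R t\<close> by \<open>K\<close>.\<close>

lemma transport_bounded_left:
  assumes IJ: "I \<subseteq> J" and e: "e \<in> I" and R: "invariant_projector I R"
    and est: "estimates I R K \<alpha>" and \<alpha>: "0 \<le> \<alpha>" and K: "0 \<le> K"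
    and Q: "R e ** Q = R e" "Q ** R e = Q" and t: "t \<in> I" "t \<le> e"
  shows "nrm (transport e Q t) \<le> K + K * nrm Q * K"
proof -
  have J: "t \<in> J" "e \<in> J" using IJ e t by auto
  have RR: "R e ** R e = R e" by (rule invariant_projectorD(1)[OF R e])
  have "Q = R e + (mat 1 - R e) ** Q ** R e"
    using Q RR by (simp add: matrix_mult.diff_left)
  then have "transport e Q t = transport e (R e) t + \<Phi> t e ** ((mat 1 - R e) ** Q ** R e) ** \<Phi> e t"
    unfolding transport_def by (metis matrix_mult.add_left matrix_mult.add_right)
  also have "transport e (R e) t = R t"
    using invariant_projector_eq_transport[OF R IJ e t(1)] by simp
  also have "\<Phi> t e ** ((mat 1 - R e) ** Q ** R e) ** \<Phi> e t
      = (\<Phi> t e ** (mat 1 - R e)) ** Q ** (\<Phi> e t ** R t)"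
    using invariant_projectorD(2)[OF R e t(1)] by (metis matrix_mul_assoc)
  finally have eq: "transport e Q t = R t + (\<Phi> t e ** (mat 1 - R e)) ** Q ** (\<Phi> e t ** R t)" .
  have "K * (h e / h t) powr (- \<alpha>) \<le> K"
    using decay_le_1[OF J t(2) \<alpha>] K by (simp add: mult_left_le)
  then have "nrm (\<Phi> t e ** (mat 1 - R e)) \<le> K" "nrm (\<Phi> e t ** R t) \<le> K"
    using estimatesD(2)[OF est t(1) e t(2)] estimatesD(1)[OF est e t(1) t(2)] by linarith+
  then have "nrm ((\<Phi> t e ** (mat 1 - R e)) ** Q ** (\<Phi> e t ** R t)) \<le> K * nrm Q * K"
    by (intro nrm_mult_le order_refl)
  then show ?thesis
    unfolding eq using nrm_add projector_bounded(1)[OF est IJ t(1)]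
    by (meson add_mono order_trans)
qed

end

section \<open>Bounded solutions\<close>

lemma le_zero_if_decay:
  fixes a C \<alpha> :: real
  assumes "\<And>r. 1 \<le> r \<Longrightarrow> a \<le> C * r powr (- \<alpha>)" "0 < \<alpha>"
  shows "a \<le> 0"
proof -
  have "((\<lambda>r::real. C * r powr (- \<alpha>)) \<longlongrightarrow> C * 0) at_top"
    using assms(2) by (intro tendsto_mult_left tendsto_neg_powr filterlim_ident) auto
  then have lim: "((\<lambda>r::real. C * r powr (- \<alpha>)) \<longlongrightarrow> 0) at_top" by simp
  show ?thesis
    by (rule tendsto_lowerbound[OF lim])
       (auto intro!: eventually_mono[OF eventually_ge_at_top[of 1]] assms(1))
qed

context dichotomy_setting
begin

text \<open>The stable component at \<open>s\<close> is carried forward from an earlier time, the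
  unstable one backward from a later time. In both cases the dichotomy factor decays while the
  solution stays below \<open>B\<close>.\<close>

lemma bounded_solution_zero:
  assumes P: "invariant_projector J P" and est: "estimates J P K \<alpha>" and "0 < \<alpha>" "0 \<le> K"
    and x: "solves_linear_system J A x" and B: "\<And>t. t \<in> J \<Longrightarrow> N (x t) \<le> B"
    and s: "s \<in> J"
  shows "x s = 0"
proof -
  have step: "N (M *v x t) \<le> K * B * d" if "nrm M \<le> K * d" "t \<in> J" for M t d
  proof -
    have "N (M *v x t) \<le> nrm M * N (x t)" by (rule N_matrix_le)
    also have "\<dots> \<le> (K * d) * B"
      using that B[OF that(2)] order_trans[OF nrm_nonneg that(1)] by (intro mult_mono) auto
    finally show ?thesis by (simp add: mult_ac)
  qed
  have "N (P s *v x s) \<le> K * B * r powr (- \<alpha>)" if r: "1 \<le> r" for r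
  proof -
    \<comment> \<open>Since \<open>h\<close> maps \<open>J\<close> onto the positive reals, the
      ratio \<open>h s / h t\<close> can be prescribed as any \<open>r \<ge> 1\<close>; large
      \<open>r\<close> places \<open>t\<close> near the left end of \<open>J\<close>.\<close>
    obtain t where t: "t \<in> J" "h t = h s / r" using h_onto[of "h s / r"] h_pos[OF s] r by auto
    have "h t \<le> h s" using t r h_pos[OF s] by (simp add: divide_le_eq)
    then have "t \<le> s" using h_le_iff[OF t(1) s] by simp
    moreover have "h s / h t = r" using t r h_pos[OF s] by simp
    ultimately have "nrm (\<Phi> s t ** P t) \<le> K * r powr (- \<alpha>)"
      using estimatesD(1)[OF est s t(1)] by simp
    then have "N ((\<Phi> s t ** P t) *v x t) \<le> K * B * r powr (- \<alpha>)" by (rule step[OF _ t(1)])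
    also have "(\<Phi> s t ** P t) *v x t = P s *v x s"
      using solution_eq_transition[OF x t(1) s] invariant_projectorD(2)[OF P s t(1)]
      by (simp add: matrix_vector_mul_assoc)
    finally show ?thesis .
  qed
  then have "N (P s *v x s) \<le> 0" by (rule le_zero_if_decay) (use \<open>0 < \<alpha>\<close> in auto)
  moreover have "N ((mat 1 - P s) *v x s) \<le> K * B * r powr (- \<alpha>)" if r: "1 \<le> r" for r
  proof -
    \<comment> \<open>Now large \<open>r\<close> places \<open>t\<close> near the right end.\<close>
    obtain t where t: "t \<in> J" "h t = h s * r" using h_onto[of "h s * r"] h_pos[OF s] r by auto
    have "h s \<le> h t" using t r h_pos[OF s] by simp
    then have "s \<le> t" using h_le_iff[OF s t(1)] by simp
    moreover have "h t / h s = r" using t r h_pos[OF s] by simp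
    ultimately have "nrm (\<Phi> s t ** (mat 1 - P t)) \<le> K * r powr (- \<alpha>)"
      using estimatesD(2)[OF est s t(1)] by simp
    then have "N ((\<Phi> s t ** (mat 1 - P t)) *v x t) \<le> K * B * r powr (- \<alpha>)"
      by (rule step[OF _ t(1)])
    also have "(\<Phi> s t ** (mat 1 - P t)) *v x t = (mat 1 - P s) *v x s"
      using solution_eq_transition[OF x t(1) s] complement_invariant[OF P s t(1)]
      by (simp add: matrix_vector_mul_assoc)
    finally show ?thesis .
  qed
  then have "N ((mat 1 - P s) *v x s) \<le> 0" by (rule le_zero_if_decay) (use \<open>0 < \<alpha>\<close> in auto)
  ultimately have "P s *v x s = 0" "(mat 1 - P s) *v x s = 0"
    using N_pos by fastforce+
  then show ?thesis by (simp add: matrix_vector_mult_diff_rdistrib)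
qed

text \<open>To the right of \<open>e\<close> the vector \<open>v\<close> is fixed by
  \<open>Pp e\<close>, to the left by \<open>mat 1 - Pm e\<close>; the corresponding estimate
  applies with decay factor at most 1.\<close>

lemma solution_bounded_if_stable_and_unstable:
  assumes e: "e \<in> J" and \<alpha>: "0 \<le> \<alpha>" and K: "0 \<le> K"
    and left: "estimates {t \<in> J. t \<le> e} Pm K \<alpha>" and right: "estimates {e..} Pp K \<alpha>"
    and v: "Pp e *v v = v" "Pm e *v v = 0" and t: "t \<in> J"
  shows "N (\<Phi> t e *v v) \<le> K * N v"
proof -
  have bound: "N (M *v v) \<le> K * N v" if "nrm M \<le> K * d" "d \<le> 1" for M d
  proof -
    have "nrm M \<le> K" using that K mult_left_le[of d K] by linarith
    then show ?thesis
      using N_matrix_le[of M v] by (meson N_nonneg mult_right_mono order_trans)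
  qed
  show ?thesis
  proof (cases "e \<le> t")
    case True
    have "N ((\<Phi> t e ** Pp e) *v v) \<le> K * N v"
      by (rule bound[OF estimatesD(1)[OF right] decay_le_1]) (use True e t \<alpha> in auto)
    then show ?thesis using v by (simp add: matrix_vector_mul_assoc[symmetric])
  next
    case False
    have "N ((\<Phi> t e ** (mat 1 - Pm e)) *v v) \<le> K * N v"
      by (rule bound[OF estimatesD(2)[OF left] decay_le_1]) (use False e t \<alpha> in auto)
    then show ?thesis
      using v by (simp add: matrix_vector_mul_assoc[symmetric] matrix_vector_mult_diff_rdistrib)
  qed
qed

section \<open>The two implications of the equivalence\<close>

lemma half_lines_subset_J:
  assumes "e \<in> J"
  shows "{t \<in> J. t \<le> e} \<subseteq> J" "{e..} \<subseteq> J"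
  using assms by (auto simp: open_halfline_def intro: order.strict_trans2)

lemma dichotomy_from_half_lines:
  assumes e: "e \<in> J"
    and left: "uniform_dichotomy_with N J h A {t \<in> J. t \<le> e} Pm"
    and right: "uniform_dichotomy_with N J h A {e..} Pp"
    and no_bounded: "\<not> (\<exists>x. solves_linear_system J A x \<and> (\<exists>t\<in>J. x t \<noteq> 0) \<and>
              (\<exists>B. \<forall>t\<in>J. N (x t) \<le> B))"
    and index: "dichotomy_index e Pm Pp = 0"
  shows "has_uniform_dichotomy N J h A J"
proof -
  let ?Jm = "{t \<in> J. t \<le> e}" and ?Jp = "{e..}"
  note sub = half_lines_subset_J[OF e]
  have em: "e \<in> ?Jm" and ep: "e \<in> ?Jp" using e by auto
  obtain K1 \<alpha>1 where Pm: "invariant_projector ?Jm Pm" "K1 \<ge> 1" "\<alpha>1 > 0" "estimates ?Jm Pm K1 \<alpha>1"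
    using left by (auto simp: uniform_dichotomy_with_iff)
  obtain K2 \<alpha>2 where Pp: "invariant_projector ?Jp Pp" "K2 \<ge> 1" "\<alpha>2 > 0" "estimates ?Jp Pp K2 \<alpha>2"
    using right by (auto simp: uniform_dichotomy_with_iff)
  define K where "K = max K1 K2"
  define \<alpha> where "\<alpha> = min \<alpha>1 \<alpha>2"
  have K: "1 \<le> K" "0 \<le> K" and \<alpha>: "0 < \<alpha>" "0 \<le> \<alpha>"
    using Pm Pp by (auto simp: K_def \<alpha>_def)
  have estm: "estimates ?Jm Pm K \<alpha>" and estp: "estimates ?Jp Pp K \<alpha>"
    using estimates_mono[OF Pm(4) sub(1), of K \<alpha>] estimates_mono[OF Pp(4) sub(2), of K \<alpha>] K
    by (auto simp: K_def \<alpha>_def)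
  have idem: "Pm e *v (Pm e *v x) = Pm e *v x" "Pp e *v (Pp e *v x) = Pp e *v x" for x
    using invariant_projectorD(1)[OF Pm(1) em] invariant_projectorD(1)[OF Pp(1) ep]
    by (simp_all add: matrix_vector_mul_assoc)
  let ?R = "range ((*v) (Pp e))" and ?K = "{x. Pm e *v x = 0}"
  have sR: "subspace ?R" and sK: "subspace ?K"
    by (auto intro!: linear_subspace_image linear_subspace_kernel)
  \<comment> \<open>A nonzero \<open>v\<close> would start a nontrivial bounded solution.\<close>
  have "v = 0" if "v \<in> ?R \<inter> ?K" for v
  proof (rule ccontr)
    assume "v \<noteq> 0"
    have v: "Pp e *v v = v" "Pm e *v v = 0" using that idem by auto
    have "\<forall>t\<in>J. N (\<Phi> t e *v v) \<le> K * N v"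
      using solution_bounded_if_stable_and_unstable[OF e \<alpha>(2) K(2) estm estp v] by blast
    moreover have "\<Phi> e e *v v \<noteq> 0" using \<open>v \<noteq> 0\<close> by (simp add: transition_matrix_self[OF e])
    ultimately show False
      using no_bounded solves_linear_system_transition[OF e, of v] e by blast
  qed
  then have RK: "?R \<inter> ?K = {0}" using sR sK by (auto dest: subspace_0)
  have "dim ?R + dim ?K = CARD('n)" using index by (simp add: dichotomy_index_def)
  then obtain Q :: "real ^ 'n ^ 'n" where Q: "\<And>x. Q *v x \<in> ?R" "\<And>x. x - Q *v x \<in> ?K"
      "\<And>x r. r \<in> ?R \<Longrightarrow> x - r \<in> ?K \<Longrightarrow> Q *v x = r"
    using ex_projector_along_complement[OF sR sK RK] by metis
  have fix_R: "Pp e *v r = r" if "r \<in> ?R" for r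
    using that idem by auto
  have ker: "Pm e *v (x - y) = 0 \<longleftrightarrow> Pm e *v x = Pm e *v y" for x y
    by (simp add: matrix_vector_mult_diff_distrib)
  \<comment> \<open>The next four identities say that \<open>Q\<close> has the range of
    \<open>Pp e\<close> and the kernel of \<open>Pm e\<close>. They are exactly what the transport
    bounds and the change of projector require.\<close>
  have PpQ: "Pp e ** Q = Q"
    using fix_R[OF Q(1)] by (simp add: matrix_eq matrix_vector_mul_assoc[symmetric])
  have QPp: "Q ** Pp e = Pp e"
    using Q(3) by (simp add: matrix_eq matrix_vector_mul_assoc[symmetric])
  have PmQ: "Pm e ** Q = Pm e"
    using Q(2) by (simp add: matrix_eq matrix_vector_mul_assoc[symmetric] ker)
  have QPm: "Q ** Pm e = Q"
  proof -
    \<comment> \<open>The vectors \<open>x\<close> and \<open>Pm e *v x\<close> differ by an element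
      of the kernel of \<open>Pm e\<close>, so \<open>Q *v x\<close> is also the range component of
      \<open>Pm e *v x\<close>.\<close>
    have "Q *v (Pm e *v x) = Q *v x" for x
      by (rule Q(3)[OF Q(1)]) (use Q(2)[of x] in \<open>simp add: ker idem\<close>)
    then show ?thesis by (simp add: matrix_eq matrix_vector_mul_assoc[symmetric])
  qed
  have QQ: "Q ** Q = Q" by (metis PpQ QPp matrix_mul_assoc)
  let ?P = "transport e Q"
  have P: "invariant_projector J ?P" by (rule invariant_projector_transport[OF e QQ])
  \<comment> \<open>This is the bound that both transport lemmas give on their half-lines.\<close>
  define M where "M = K + K * nrm Q * K"
  have M: "0 \<le> M" using K by (simp add: M_def)
  have rel_p: "Pp t ** ?P t = ?P t" "?P t ** Pp t = Pp t" if "t \<in> ?Jp" for t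
    using that sub e invariant_projector_eq_transport[OF Pp(1) sub(2) ep that]
    by (auto simp: transport_mult PpQ QPp)
  have rel_m: "Pm t ** ?P t = Pm t" "?P t ** Pm t = ?P t" if "t \<in> ?Jm" for t
    using that sub e invariant_projector_eq_transport[OF Pm(1) sub(1) em that]
    by (auto simp: transport_mult PmQ QPm)
  have "estimates ?Jp ?P (K * (1 + M)) \<alpha>"
  proof (rule estimates_change_projector[OF sub(2) Pp(1) invariant_projector_subset[OF P sub(2)] estp K(2)])
    show "nrm (?P t) \<le> M" if "t \<in> ?Jp" for t
      unfolding M_def
      by (rule transport_bounded_right[OF sub(2) ep Pp(1) estp \<alpha>(2) K(2) PpQ QPp that])
         (use that in auto)
  qed (use rel_p in auto)
  moreover have "estimates ?Jm ?P (K * (1 + M)) \<alpha>"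
  proof (rule estimates_change_projector[OF sub(1) Pm(1) invariant_projector_subset[OF P sub(1)] estm K(2)])
    show "nrm (?P t) \<le> M" if "t \<in> ?Jm" for t
      unfolding M_def
      by (rule transport_bounded_left[OF sub(1) em Pm(1) estm \<alpha>(2) K(2) PmQ QPm that])
         (use that in auto)
  qed (use rel_m in auto)
  moreover have KM: "1 \<le> K * (1 + M)"
    using mult_mono[of 1 K 1 "1 + M"] K M by simp
  ultimately have "estimates J ?P (K * (1 + M) * (K * (1 + M))) \<alpha>"
    by (intro estimates_glue[OF e P])
  moreover have "1 \<le> K * (1 + M) * (K * (1 + M))"
    using mult_mono[OF KM KM] KM by simp
  ultimately show ?thesis
    unfolding has_uniform_dichotomy_def uniform_dichotomy_with_iff using P \<alpha>(1) by blast
qed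

text \<open>The projector of the dichotomy on \<open>J\<close> serves on both half-lines, so the
  index is the rank plus the nullity of \<open>P e\<close> minus the dimension.\<close>

lemma dichotomy_to_half_lines:
  assumes e: "e \<in> J" and P: "uniform_dichotomy_with N J h A J P"
  shows "uniform_dichotomy_with N J h A {t \<in> J. t \<le> e} P"
    and "uniform_dichotomy_with N J h A {e..} P"
    and "\<not> (\<exists>x. solves_linear_system J A x \<and> (\<exists>t\<in>J. x t \<noteq> 0) \<and>
              (\<exists>B. \<forall>t\<in>J. N (x t) \<le> B))"
    and "dichotomy_index e P P = 0"
proof -
  obtain K \<alpha> where K: "K \<ge> 1" "\<alpha> > 0" and inv: "invariant_projector J P"
    and est: "estimates J P K \<alpha>"
    using P by (auto simp: uniform_dichotomy_with_iff)
  note sub = half_lines_subset_J[OF e]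
  show "uniform_dichotomy_with N J h A {t \<in> J. t \<le> e} P" "uniform_dichotomy_with N J h A {e..} P"
    unfolding uniform_dichotomy_with_iff
    using K invariant_projector_subset[OF inv sub(1)] invariant_projector_subset[OF inv sub(2)]
      estimates_subset[OF est sub(1)] estimates_subset[OF est sub(2)] by blast+
  show "\<not> (\<exists>x. solves_linear_system J A x \<and> (\<exists>t\<in>J. x t \<noteq> 0) \<and>
              (\<exists>B. \<forall>t\<in>J. N (x t) \<le> B))"
  proof (intro notI, elim exE conjE bexE)
    fix x t B
    assume "solves_linear_system J A x" "\<forall>t\<in>J. N (x t) \<le> B" "t \<in> J" "x t \<noteq> 0"
    then show False
      using bounded_solution_zero[OF inv est K(2), of x B t] K(1) by auto
  qed
  show "dichotomy_index e P P = 0"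
    using projector_range_kernel_dim[OF invariant_projectorD(1)[OF inv e]]
    by (simp add: dichotomy_index_def)
qed

end

theorem theorem2:
  fixes N :: "real ^ 'n \<Rightarrow> real"
    and a\<^sub>0 :: ereal
    and h :: "real \<Rightarrow> real"
    and A :: "real \<Rightarrow> real ^ 'n ^ 'n"
    and J Jm Jp :: "real set"
    and e :: real
  assumes "is_norm N"
    and "a\<^sub>0 < \<infinity>"
    and J_def: "J = open_halfline a\<^sub>0"
    and "growth_rate J h"
    and e_def: "e = the_inv_into J h 1"
    and Jm_def: "Jm = {t \<in> J. t \<le> e}"
    and Jp_def: "Jp = {e..}"
    and "continuous_on J A"
  shows "has_uniform_dichotomy N J h A J \<longleftrightarrow>
    (\<exists>Pm Pp.
       uniform_dichotomy_with N J h A Jm Pm \<and>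
       uniform_dichotomy_with N J h A Jp Pp \<and>
       \<not> (\<exists>x. solves_linear_system J A x \<and> (\<exists>t\<in>J. x t \<noteq> 0) \<and>
              (\<exists>B. \<forall>t\<in>J. N (x t) \<le> B)) \<and>
       dichotomy_index e Pm Pp = 0)"
proof -
  interpret dichotomy_setting a\<^sub>0 A N h
    by unfold_locales (use assms in auto)
  have "inj_on h J"
    using strict_mono_h by (simp add: J_def strict_mono_on_imp_inj_on)
  then have e: "e \<in> open_halfline a\<^sub>0"
    unfolding e_def J_def by (intro the_inv_into_into) (auto simp: h_image)
  show ?thesis
    unfolding Jm_def Jp_def J_def
  proof (intro iffI; (elim exE conjE)?)
    assume "has_uniform_dichotomy N (open_halfline a\<^sub>0) h A (open_halfline a\<^sub>0)"
    then obtain P where P: "uniform_dichotomy_with N (open_halfline a\<^sub>0) h A (open_halfline a\<^sub>0) P"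
      by (auto simp: has_uniform_dichotomy_def)
    show "\<exists>Pm Pp. uniform_dichotomy_with N (open_halfline a\<^sub>0) h A {t \<in> open_halfline a\<^sub>0. t \<le> e} Pm \<and>
       uniform_dichotomy_with N (open_halfline a\<^sub>0) h A {e..} Pp \<and>
       \<not> (\<exists>x. solves_linear_system (open_halfline a\<^sub>0) A x \<and> (\<exists>t\<in>open_halfline a\<^sub>0. x t \<noteq> 0) \<and>
              (\<exists>B. \<forall>t\<in>open_halfline a\<^sub>0. N (x t) \<le> B)) \<and>
       dichotomy_index e Pm Pp = 0"
      by (rule exI[of _ P], rule exI[of _ P]) (intro conjI dichotomy_to_half_lines[OF e P])
  qed (rule dichotomy_from_half_lines[OF e]; assumption)
qed

end
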